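(* Let $n$ be a positive integer. If $C$ is a critical set of minimal size in the Latin square $L(2^n)$, then $$|C| \leq 4^n - 3^n + 4 - 2^n - 2^{n-2}.$$
   Context: A Latin square $L$ of order $N$ is an $N\times N$ array, with rows and columns indexed by $\{0,\dots,N-1\}$, such that each row and each column contains each of the $N$ elements $0,\dots,N-1$ exactly once. It is identified with the set of its entries $(i,j;k)$, meaning that the cell in row $i$ and column $j$ contains $k$. A subset $C\subseteq L$ is uniquely completable (to $L$) if $L$ is the only Latin square of order $N$ (on the same rows, columns and elements) that contains $C$. A critical set of $L$ (or in $L$) is a subset $C\subseteq L$ that is uniquely completable to $L$ and such that no proper subset of $C$ is uniquely completable to $L$. A critical set of minimal size in $L$ is a critical set of $L$ of smallest cardinality among all critical sets of $L$. $L(2^n)$ is the Latin square of order $2^n$ given by the Cayley table of the elementary abelian 2-group $(\mathbb{Z}/2)^n$; explicitly, the entry in row $i$ and column $j$, $0\le i,j\le 2^n-1$, is the bitwise exclusive-or (XOR) of $i$ and $j$. *)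

theory Defs
  imports Complex_Main
begin

text \<open>An array of order \<open>N\<close> is a function \<open>A\<close> of which only the values \<open>A i j\<close> with \<open>i, j < N\<close>
  matter. A Latin square is identified with the set of its entries, so that two arrays
  that agree on these cells give the same square.\<close>

definition latin_array :: "nat \<Rightarrow> (nat \<Rightarrow> nat \<Rightarrow> nat) \<Rightarrow> bool" where
  "latin_array N A \<longleftrightarrow>
     (\<forall>i<N. bij_betw (\<lambda>j. A i j) {..<N} {..<N}) \<and>
     (\<forall>j<N. bij_betw (\<lambda>i. A i j) {..<N} {..<N})"

type_synonym entry = "nat \<times> nat \<times> nat"

definition entries :: "nat \<Rightarrow> (nat \<Rightarrow> nat \<Rightarrow> nat) \<Rightarrow> entry set" where
  "entries N A = {(i, j, A i j) | i j. i < N \<and> j < N}"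

definition latin_square :: "nat \<Rightarrow> entry set \<Rightarrow> bool" where
  "latin_square N L \<longleftrightarrow> (\<exists>A. latin_array N A \<and> L = entries N A)"

text \<open>The equation below includes that \<open>L\<close> is a Latin square of order \<open>N\<close> and that \<open>C \<subseteq> L\<close>.\<close>

definition uniquely_completable :: "nat \<Rightarrow> entry set \<Rightarrow> entry set \<Rightarrow> bool" where
  "uniquely_completable N L C \<longleftrightarrow> {L'. latin_square N L' \<and> C \<subseteq> L'} = {L}"

definition critical_set :: "nat \<Rightarrow> entry set \<Rightarrow> entry set \<Rightarrow> bool" where
  "critical_set N L C \<longleftrightarrow>
     uniquely_completable N L C \<and> (\<forall>D. D \<subset> C \<longrightarrow> \<not> uniquely_completable N L D)"

definition minimal_critical_set :: "nat \<Rightarrow> entry set \<Rightarrow> entry set \<Rightarrow> bool" where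
  "minimal_critical_set N L C \<longleftrightarrow> is_arg_min card (critical_set N L) C"

definition xor_square :: "nat \<Rightarrow> entry set" where
  "xor_square n = entries (2 ^ n) xor"

lemma xor_less_2_power:
  fixes i j :: nat
  assumes "i < 2 ^ n" "j < 2 ^ n"
  shows "xor i j < 2 ^ n"
  using assms by (metis take_bit_nat_eq_self_iff take_bit_xor)

lemma xor_xor_cancel: "xor i (xor i j) = (j :: nat)"
  by (rule bit_eqI) (auto simp: bit_xor_iff)

lemma latin_square_xor_square: "latin_square (2 ^ n) (xor_square n)"
proof -
  have row: "bij_betw (\<lambda>j. xor i j) {..<2 ^ n} {..<2 ^ n}" if "i < 2 ^ n" for i :: nat
    by (rule bij_betw_byWitness[where f' = "\<lambda>j. xor i j"])
      (use that in \<open>auto simp: xor_xor_cancel xor_less_2_power\<close>)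
  then have "latin_array (2 ^ n) xor"
    using row by (simp add: latin_array_def xor.commute)
  then show ?thesis
    by (auto simp: latin_square_def xor_square_def)
qed

end

theory Submission
  imports Defs
begin

text \<open>
  A critical set of minimal size is no larger than any uniquely completable subset, because
  every finite uniquely completable set contains a critical one. So it is enough to delete many
  entries from \<open>L(2\<^sup>n)\<close> while leaving the rest uniquely completable.

  Deleted entries are tracked through their set of cells \<open>U\<close>, called recoverable if the entries
  in all other cells determine the square. The engine is a doubling step that triples \<open>U\<close>. Split
  the square of order \<open>2N\<close> into four quadrants of order \<open>N\<close>, keep the lower right quadrant in
  full, and delete a copy of \<open>U\<close> from each of the other three. The lower right quadrant already
  uses up all the small symbols (those below \<open>N\<close>) in the lower rows and in the right columns.
  Hence the lower left and the upper right quadrant of any completion contain only large symbols,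
  and therefore the upper left one contains only small symbols. So each quadrant of a completion
  is a Latin square of order \<open>N\<close> in its own right, and each is restored independently because
  \<open>U\<close> is recoverable.

  In \<open>L(4)\<close> one can delete 11 of the 16 entries, which are then restored by forced moves. Doubling
  gives \<open>11 \<cdot> 3\<^sup>n\<^sup>-\<^sup>2\<close> deleted cells in \<open>L(2\<^sup>n)\<close>, thus uniquely completable sets of size
  \<open>4\<^sup>n - 11 \<cdot> 3\<^sup>n\<^sup>-\<^sup>2 = 4\<^sup>n - 3\<^sup>n - 2 \<cdot> 3\<^sup>n\<^sup>-\<^sup>2\<close> for \<open>n \<ge> 2\<close>, and
  \<open>2 \<cdot> 3\<^sup>n\<^sup>-\<^sup>2 \<ge> 2\<^sup>n + 2\<^sup>n\<^sup>-\<^sup>2 - 4\<close>, with equality for \<open>n = 3\<close>. For \<open>n = 1\<close> the doubling starts from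
  the square of order 1 with its only entry deleted.
\<close>

section \<open>Recoverable sets of cells\<close>

definition recoverable :: "nat \<Rightarrow> (nat \<Rightarrow> nat \<Rightarrow> nat) \<Rightarrow> (nat \<times> nat) set \<Rightarrow> bool" where
  "recoverable N A U \<longleftrightarrow>
     (\<forall>B. latin_array N B \<longrightarrow> (\<forall>i<N. \<forall>j<N. (i, j) \<notin> U \<longrightarrow> B i j = A i j) \<longrightarrow>
        (\<forall>i<N. \<forall>j<N. B i j = A i j))"

lemma recoverableD:
  assumes "recoverable N A U" "latin_array N B"
    and "\<And>i j. i < N \<Longrightarrow> j < N \<Longrightarrow> (i, j) \<notin> U \<Longrightarrow> B i j = A i j"
    and "i < N" "j < N"
  shows "B i j = A i j"
  using assms unfolding recoverable_def by blast

lemma recoverable_cong: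
  assumes "\<And>i j. i < N \<Longrightarrow> j < N \<Longrightarrow> A i j = A' i j"
  shows "recoverable N A U \<longleftrightarrow> recoverable N A' U"
  using assms unfolding recoverable_def by simp

lemma latin_array_less:
  assumes "latin_array N A" "i < N" "j < N"
  shows "A i j < N"
  using assms unfolding latin_array_def bij_betw_def by blast

lemma uniquely_completable_of_recoverable:
  assumes "latin_array N A" "recoverable N A U"
  shows "uniquely_completable N (entries N A) {(i, j, A i j) | i j. i < N \<and> j < N \<and> (i, j) \<notin> U}"
    (is "uniquely_completable N _ ?C")
proof -
  have "L' = entries N A" if L': "latin_square N L'" "?C \<subseteq> L'" for L'
  proof -
    obtain B where B: "latin_array N B" "L' = entries N B"
      using L'(1) unfolding latin_square_def by blast
    have "B i j = A i j" if "i < N" "j < N" "(i, j) \<notin> U" for i j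
    proof -
      have "(i, j, A i j) \<in> L'"
        using that by (intro subsetD[OF L'(2)]) simp
      then show ?thesis
        by (simp add: B(2) entries_def)
    qed
    then have "B i j = A i j" if "i < N" "j < N" for i j
      using recoverableD[OF assms(2) B(1) _ that] by simp
    then show ?thesis
      unfolding B(2) entries_def by (intro Collect_cong) metis
  qed
  moreover have "latin_square N (entries N A)" "?C \<subseteq> entries N A"
    using assms(1) unfolding latin_square_def entries_def by blast+
  ultimately show ?thesis
    unfolding uniquely_completable_def by blast
qed

lemma card_entries_off:
  assumes "U \<subseteq> {..<N} \<times> {..<N}"
  shows "card {(i, j, A i j) | i j. i < N \<and> j < N \<and> (i, j) \<notin> U} = N * N - card U"
proof -
  have "{(i, j, A i j) | i j. i < N \<and> j < N \<and> (i, j) \<notin> U}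
      = (\<lambda>(i, j). (i, j, A i j)) ` ({..<N} \<times> {..<N} - U)"
    by auto
  moreover have "inj_on (\<lambda>(i, j). (i, j, A i j)) ({..<N} \<times> {..<N} - U)"
    by (auto simp: inj_on_def)
  ultimately have "card {(i, j, A i j) | i j. i < N \<and> j < N \<and> (i, j) \<notin> U}
      = card ({..<N} \<times> {..<N} - U)"
    by (simp add: card_image)
  also have "\<dots> = N * N - card U"
    using assms by (subst card_Diff_subset) (auto intro: finite_subset)
  finally show ?thesis .
qed

text \<open>A uniquely completable subset of least cardinality is critical.\<close>

lemma critical_subset_exists:
  assumes "uniquely_completable N L D" "finite D"
  obtains E where "critical_set N L E" "E \<subseteq> D"
proof -
  obtain E where E: "E \<subseteq> D \<and> uniquely_completable N L E"
    and least: "\<And>F. F \<subseteq> D \<and> uniquely_completable N L F \<Longrightarrow> card E \<le> card F"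
    using ex_has_least_nat[of "\<lambda>E. E \<subseteq> D \<and> uniquely_completable N L E" D card] assms(1) by blast
  have "\<not> uniquely_completable N L F" if "F \<subset> E" for F
    using that E least[of F] psubset_card_mono[of E F] finite_subset[OF _ assms(2)]
    by (meson leD order.strict_implies_order order_trans)
  then show ?thesis
    using that E unfolding critical_set_def by blast
qed

lemma minimal_critical_set_card_le:
  assumes "minimal_critical_set N L C" "uniquely_completable N L D" "finite D"
  shows "card C \<le> card D"
proof -
  obtain E where E: "critical_set N L E" "E \<subseteq> D"
    using critical_subset_exists assms(2,3) by blast
  have "card C \<le> card E"
    using assms(1) E(1) unfolding minimal_critical_set_def is_arg_min_def by (meson not_le)
  also have "\<dots> \<le> card D"
    using E(2) assms(3) by (simp add: card_mono)
  finally show ?thesis .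
qed

section \<open>Doubling a square\<close>

text \<open>The direct product of a square with the group of order 2.\<close>

definition double :: "nat \<Rightarrow> (nat \<Rightarrow> nat \<Rightarrow> nat) \<Rightarrow> nat \<Rightarrow> nat \<Rightarrow> nat" where
  "double N A i j = A (i mod N) (j mod N) + (if (i < N) = (j < N) then 0 else N)"

lemma double_quadrants:
  assumes "i < N" "j < N"
  shows "double N A i j = A i j" "double N A i (j + N) = A i j + N"
    "double N A (i + N) j = A i j + N" "double N A (i + N) (j + N) = A i j"
  using assms by (simp_all add: double_def)

definition triple_cells :: "nat \<Rightarrow> (nat \<times> nat) set \<Rightarrow> (nat \<times> nat) set" where
  "triple_cells N U = U \<union> (\<lambda>(i, j). (i, j + N)) ` U \<union> (\<lambda>(i, j). (i + N, j)) ` U"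

lemma triple_cells_subset:
  assumes "U \<subseteq> {..<N} \<times> {..<N}"
  shows "triple_cells N U \<subseteq> {..<2 * N} \<times> {..<2 * N}"
  using assms unfolding triple_cells_def by fastforce

lemma card_triple_cells:
  assumes "U \<subseteq> {..<N} \<times> {..<N}"
  shows "card (triple_cells N U) = 3 * card U"
proof -
  let ?r = "(\<lambda>(i, j). (i, j + N)) ` U" and ?l = "(\<lambda>(i, j). (i + N, j)) ` U"
  have "finite U"
    using assms by (rule finite_subset) simp
  moreover have "U \<inter> ?r = {}" "(U \<union> ?r) \<inter> ?l = {}"
    using assms by fastforce+
  moreover have "card ?r = card U" "card ?l = card U"
    by (auto intro!: card_image simp: inj_on_def)
  ultimately show ?thesis
    unfolding triple_cells_def by (simp add: card_Un_disjoint)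
qed

text \<open>The counting behind the doubling step: a line whose one half uses only one half of the
  symbols uses all of those there, which leaves the other symbols for its other half.\<close>

lemma bij_betw_halves:
  assumes "bij_betw f (S \<union> T) (X \<union> Y)" "S \<inter> T = {}" "X \<inter> Y = {}"
    and "finite Y" "card T = card Y" "f ` T \<subseteq> Y"
  shows "bij_betw f T Y" "bij_betw f S X"
proof -
  have "inj_on f (S \<union> T)"
    using assms(1) by (rule bij_betw_imp_inj_on)
  then have inj: "inj_on f S" "inj_on f T" "f ` S \<inter> f ` T = {}"
    using assms(2) by (auto simp: inj_on_Un)
  have "card (f ` T) = card Y"
    using inj(2) assms(5) by (simp add: card_image)
  then have T: "f ` T = Y"
    using assms(4,6) by (simp add: card_subset_eq)
  then show "bij_betw f T Y"
    using inj(2) by (simp add: bij_betw_def)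
  have "f ` S \<union> f ` T = X \<union> Y"
    using assms(1) by (simp add: bij_betw_def image_Un)
  then have "f ` S = X"
    using T inj(3) assms(3) by blast
  then show "bij_betw f S X"
    using inj(1) by (simp add: bij_betw_def)
qed

lemma bij_betw_shift_dom:
  fixes N :: nat
  assumes "bij_betw f {N..<2 * N} Y"
  shows "bij_betw (\<lambda>x. f (x + N)) {..<N} Y"
proof -
  have "bij_betw (\<lambda>x. x + N) {..<N} {N..<2 * N}"
    by (rule bij_betw_byWitness[where f' = "\<lambda>x. x - N"]) auto
  from bij_betw_trans[OF this assms] show ?thesis
    by (simp add: o_def)
qed

lemma bij_betw_shift_ran:
  fixes N :: nat
  assumes "bij_betw f S {N..<2 * N}"
  shows "bij_betw (\<lambda>x. f x - N) S {..<N}"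
proof -
  have "bij_betw (\<lambda>x. x - N) {N..<2 * N} {..<N}"
    by (rule bij_betw_byWitness[where f' = "\<lambda>x. x + N"]) auto
  from bij_betw_trans[OF assms this] show ?thesis
    by (simp add: o_def)
qed

text \<open>A small-valued lower right quadrant forces the other three quadrants to be Latin squares
  on the large, the large and the small symbols.\<close>

lemma latin_array_quadrants:
  assumes B: "latin_array (2 * N) B"
    and small: "\<And>i j. i \<in> {N..<2 * N} \<Longrightarrow> j \<in> {N..<2 * N} \<Longrightarrow> B i j < N"
  shows "latin_array N B"
    and "latin_array N (\<lambda>i j. B i (j + N) - N)"
    and "latin_array N (\<lambda>i j. B (i + N) j - N)"
    and "i < N \<Longrightarrow> j < N \<Longrightarrow> N \<le> B i (j + N)"
    and "i < N \<Longrightarrow> j < N \<Longrightarrow> N \<le> B (i + N) j"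
proof -
  let ?lo = "{..<N}" and ?hi = "{N..<2 * N}"
  have split: "{..<2 * N} = ?lo \<union> ?hi" "{..<2 * N} = ?hi \<union> ?lo"
    by auto
  have disjoint: "?lo \<inter> ?hi = {}"
    by auto
  have row: "bij_betw (\<lambda>j. B i j) {..<2 * N} {..<2 * N}" if "i < 2 * N" for i
    using B that unfolding latin_array_def by blast
  have col: "bij_betw (\<lambda>i. B i j) {..<2 * N} {..<2 * N}" if "j < 2 * N" for j
    using B that unfolding latin_array_def by blast
  have lower_row: "bij_betw (\<lambda>j. B i j) ?lo ?hi" if "i \<in> ?hi" for i
  proof (rule bij_betw_halves(2)[where T = ?hi and Y = ?lo])
    show "bij_betw (\<lambda>j. B i j) (?lo \<union> ?hi) (?hi \<union> ?lo)"
      using row[of i] that split by simp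
  qed (use small that in auto)
  have right_col: "bij_betw (\<lambda>i. B i j) ?lo ?hi" if "j \<in> ?hi" for j
  proof (rule bij_betw_halves(2)[where T = ?hi and Y = ?lo])
    show "bij_betw (\<lambda>i. B i j) (?lo \<union> ?hi) (?hi \<union> ?lo)"
      using col[of j] that split by simp
  qed (use small that in auto)
  have left_col: "bij_betw (\<lambda>i. B i j) ?hi ?hi" "bij_betw (\<lambda>i. B i j) ?lo ?lo" if "j \<in> ?lo" for j
  proof -
    have *: "bij_betw (\<lambda>i. B i j) (?lo \<union> ?hi) (?lo \<union> ?hi)"
      using col[of j] that split(1) by simp
    have "(\<lambda>i. B i j) ` ?hi \<subseteq> ?hi"
      using lower_row that by (blast dest: bij_betwE)
    then show "bij_betw (\<lambda>i. B i j) ?hi ?hi" "bij_betw (\<lambda>i. B i j) ?lo ?lo"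
      using bij_betw_halves[OF * disjoint disjoint] by auto
  qed
  have upper_row: "bij_betw (\<lambda>j. B i j) ?hi ?hi" "bij_betw (\<lambda>j. B i j) ?lo ?lo" if "i \<in> ?lo" for i
  proof -
    have *: "bij_betw (\<lambda>j. B i j) (?lo \<union> ?hi) (?lo \<union> ?hi)"
      using row[of i] that split(1) by simp
    have "(\<lambda>j. B i j) ` ?hi \<subseteq> ?hi"
      using right_col that by (blast dest: bij_betwE)
    then show "bij_betw (\<lambda>j. B i j) ?hi ?hi" "bij_betw (\<lambda>j. B i j) ?lo ?lo"
      using bij_betw_halves[OF * disjoint disjoint] by auto
  qed
  show "latin_array N B"
    using upper_row(2) left_col(2) unfolding latin_array_def by simp
  show "latin_array N (\<lambda>i j. B i (j + N) - N)"
    unfolding latin_array_def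
  proof (intro conjI allI impI)
    show "bij_betw (\<lambda>j. B i (j + N) - N) ?lo ?lo" if "i < N" for i
      by (intro bij_betw_shift_ran bij_betw_shift_dom upper_row) (simp add: that)
    show "bij_betw (\<lambda>i. B i (j + N) - N) ?lo ?lo" if "j < N" for j
      by (intro bij_betw_shift_ran right_col) (use that in simp)
  qed
  show "latin_array N (\<lambda>i j. B (i + N) j - N)"
    unfolding latin_array_def
  proof (intro conjI allI impI)
    show "bij_betw (\<lambda>j. B (i + N) j - N) ?lo ?lo" if "i < N" for i
      by (intro bij_betw_shift_ran lower_row) (use that in simp)
    show "bij_betw (\<lambda>i. B (i + N) j - N) ?lo ?lo" if "j < N" for j
      by (intro bij_betw_shift_ran bij_betw_shift_dom left_col) (simp add: that)
  qed
  show "N \<le> B i (j + N)" if "i < N" "j < N"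
    using bij_betwE[OF right_col[of "j + N"]] that by auto
  show "N \<le> B (i + N) j" if "i < N" "j < N"
    using bij_betwE[OF lower_row[of "i + N"]] that by auto
qed

lemma offset_in_half:
  fixes x N :: nat
  assumes "x < 2 * N"
  shows "\<exists>a<N. x = a \<or> x = a + N"
  by (rule exI[of _ "if x < N then x else x - N"]) (use assms in auto)

text \<open>In a completion of the doubled square, each quadrant other than the lower right one is a
  Latin square of order \<open>N\<close>, after subtracting \<open>N\<close> from large symbols, and agrees with
  \<open>A\<close> off \<open>U\<close>. So the hypothesis on \<open>U\<close> restores each of them separately.\<close>

theorem recoverable_double:
  assumes A: "latin_array N A" and U: "U \<subseteq> {..<N} \<times> {..<N}" and rec: "recoverable N A U"
  shows "recoverable (2 * N) (double N A) (triple_cells N U)"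
  unfolding recoverable_def
proof (intro allI impI)
  fix B i j
  assume B: "latin_array (2 * N) B"
    and agree: "\<forall>i<2 * N. \<forall>j<2 * N. (i, j) \<notin> triple_cells N U \<longrightarrow> B i j = double N A i j"
    and ij: "i < 2 * N" "j < 2 * N"
  have lower_right: "B (i + N) (j + N) = A i j" if "i < N" "j < N" for i j
  proof -
    have "(i + N, j + N) \<notin> triple_cells N U"
      using U by (auto simp: triple_cells_def)
    then show ?thesis
      using agree that by (simp add: double_quadrants)
  qed
  have "B i j < N" if "i \<in> {N..<2 * N}" "j \<in> {N..<2 * N}" for i j
  proof -
    have "B i j = A (i - N) (j - N)"
      using lower_right[of "i - N" "j - N"] that by auto
    then show ?thesis
      using latin_array_less[OF A, of "i - N" "j - N"] that by auto
  qed
  note quadrants = latin_array_quadrants[OF B this]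
  have upper_left: "B i j = A i j" if "i < N" "j < N" for i j
  proof (rule recoverableD[OF rec quadrants(1) _ that])
    fix i j assume *: "i < N" "j < N" "(i, j) \<notin> U"
    then have "(i, j) \<notin> triple_cells N U"
      by (auto simp: triple_cells_def)
    then show "B i j = A i j"
      using agree * by (simp add: double_quadrants)
  qed
  have "B i (j + N) - N = A i j" if "i < N" "j < N" for i j
  proof (rule recoverableD[OF rec quadrants(2) _ that])
    fix i j assume *: "i < N" "j < N" "(i, j) \<notin> U"
    then have "(i, j + N) \<notin> triple_cells N U"
      using U by (auto simp: triple_cells_def)
    then show "B i (j + N) - N = A i j"
      using agree * by (simp add: double_quadrants)
  qed
  then have upper_right: "B i (j + N) = A i j + N" if "i < N" "j < N" for i j
    using quadrants(4) that by (metis le_add_diff_inverse2)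
  have "B (i + N) j - N = A i j" if "i < N" "j < N" for i j
  proof (rule recoverableD[OF rec quadrants(3) _ that])
    fix i j assume *: "i < N" "j < N" "(i, j) \<notin> U"
    then have "(i + N, j) \<notin> triple_cells N U"
      using U by (auto simp: triple_cells_def)
    then show "B (i + N) j - N = A i j"
      using agree * by (simp add: double_quadrants)
  qed
  then have lower_left: "B (i + N) j = A i j + N" if "i < N" "j < N" for i j
    using quadrants(5) that by (metis le_add_diff_inverse2)
  obtain a b where ab: "a < N" "b < N" and "i = a \<or> i = a + N" "j = b \<or> j = b + N"
    using offset_in_half[OF ij(1)] offset_in_half[OF ij(2)] by blast
  then show "B i j = double N A i j"
    by (elim disjE)
      (simp_all add: double_quadrants upper_left upper_right lower_left lower_right)
qed

section \<open>Deleting cells from the elementary abelian 2-groups\<close>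

lemma latin_array_xor: "latin_array (2 ^ n) xor"
proof -
  have "bij_betw (\<lambda>j. xor i j) {..<2 ^ n} {..<2 ^ n}" if "i < 2 ^ n" for i :: nat
    by (rule bij_betw_byWitness[where f' = "\<lambda>j. xor i j"])
      (use that in \<open>auto simp: xor_xor_cancel xor_less_2_power\<close>)
  then show ?thesis
    by (simp add: latin_array_def xor.commute)
qed

lemma add_2_power_eq_xor:
  fixes a :: nat
  assumes "a < 2 ^ n"
  shows "a + 2 ^ n = xor a (2 ^ n)"
proof (rule disjunctive_add_eq_xor)
  show "and a (2 ^ n) = 0"
    using assms by (auto simp: and_exp_eq_0_iff_not_bit bit_nat_def)
qed

text \<open>Doubling adjoins a new leading bit, which is set exactly in the lower rows, the right columns
  and the large symbols.\<close>

lemma xor_eq_double: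
  fixes i j :: nat
  assumes "i < 2 * 2 ^ n" "j < 2 * 2 ^ n"
  shows "xor i j = double (2 ^ n) xor i j"
proof -
  obtain a b where ab: "a < 2 ^ n" "b < 2 ^ n"
    and "i = a \<or> i = a + 2 ^ n" "j = b \<or> j = b + 2 ^ n"
    using offset_in_half[OF assms(1)] offset_in_half[OF assms(2)] by blast
  moreover have "xor a b + 2 ^ n = xor (xor a b) (2 ^ n)"
    using add_2_power_eq_xor[OF xor_less_2_power[OF ab]] .
  moreover have "a + 2 ^ n = xor a (2 ^ n)" "b + 2 ^ n = xor b (2 ^ n)"
    using add_2_power_eq_xor ab by blast+
  moreover note double_quadrants[OF ab, of xor]
  ultimately show ?thesis
    by (elim disjE) (simp_all add: ac_simps xor_xor_cancel)
qed

lemma recoverable_xor_iterate: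
  assumes "U \<subseteq> {..<2 ^ k} \<times> {..<2 ^ k}" "recoverable (2 ^ k) xor U"
  shows "\<exists>V \<subseteq> {..<2 ^ (k + m)} \<times> {..<2 ^ (k + m)}.
    recoverable (2 ^ (k + m)) xor V \<and> card V = 3 ^ m * card U"
proof (induction m)
  case 0
  then show ?case
    using assms by auto
next
  case (Suc m)
  let ?N = "2 ^ (k + m) :: nat"
  obtain V where V: "V \<subseteq> {..<?N} \<times> {..<?N}" "recoverable ?N xor V" "card V = 3 ^ m * card U"
    using Suc.IH by blast
  have "recoverable (2 * ?N) xor (triple_cells ?N V)
      \<longleftrightarrow> recoverable (2 * ?N) (double ?N xor) (triple_cells ?N V)"
    by (intro recoverable_cong xor_eq_double)
  then have "recoverable (2 * ?N) xor (triple_cells ?N V)"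
    using recoverable_double[OF latin_array_xor V(1,2)] by blast
  then show ?case
    using triple_cells_subset[OF V(1)] card_triple_cells[OF V(1)] V(3)
    by (intro exI[of _ "triple_cells ?N V"]) simp
qed

text \<open>The solving move for a cell all but one of whose symbols are blocked by its row or
  column.\<close>

lemma latin_array_forced:
  assumes "latin_array N B" "i < N" "j < N"
    and blocked: "\<forall>u<N. u \<noteq> v \<longrightarrow> (\<exists>j'<N. j' \<noteq> j \<and> B i j' = u) \<or> (\<exists>i'<N. i' \<noteq> i \<and> B i' j = u)"
  shows "B i j = v"
proof (rule ccontr)
  assume "B i j \<noteq> v"
  moreover have "B i j < N"
    using latin_array_less assms(1-3) .
  ultimately consider j' where "j' < N" "j' \<noteq> j" "B i j' = B i j"
    | i' where "i' < N" "i' \<noteq> i" "B i' j = B i j"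
    using blocked by blast
  then show False
    using assms(1-3) unfolding latin_array_def bij_betw_def inj_on_def by cases blast+
qed

definition cells4 :: "(nat \<times> nat) set" where
  "cells4 = {..<4} \<times> {..<4} - {(0, 0), (1, 2), (1, 3), (2, 1), (3, 2)}"

lemma card_cells4: "card cells4 = 11"
  unfolding cells4_def by (subst card_Diff_subset) auto

text \<open>The five entries that remain are
  \<open>0 . . .\<close> / \<open>. . 3 2\<close> / \<open>. 3 . .\<close> / \<open>. . 1 .\<close>, row by row.\<close>

lemma recoverable_cells4: "recoverable 4 xor cells4"
  unfolding recoverable_def
proof (intro allI impI)
  fix B :: "nat \<Rightarrow> nat \<Rightarrow> nat" and i j :: nat
  assume B: "latin_array 4 B"
    and agree: "\<forall>i<4. \<forall>j<4. (i, j) \<notin> cells4 \<longrightarrow> B i j = xor i j"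
    and ij: "i < 4" "j < 4"
  note forced = latin_array_forced[OF B]
  have less4: "(\<forall>u<4. P u) \<longleftrightarrow> P 0 \<and> P 1 \<and> P 2 \<and> P 3"
    "(\<exists>u<4. P u) \<longleftrightarrow> P 0 \<or> P 1 \<or> P 2 \<or> P 3" for P :: "nat \<Rightarrow> bool"
    by (auto simp: numeral_eq_Suc less_Suc_eq)
  have given: "B 0 0 = 0" "B 1 2 = 3" "B 1 3 = 2" "B 2 1 = 3" "B 3 2 = 1"
    using agree unfolding less4 cells4_def by simp_all
  have 02: "B 0 2 = 2" by (rule forced) (simp_all add: less4 given del: One_nat_def)
  have 22: "B 2 2 = 0" by (rule forced) (simp_all add: less4 given 02 del: One_nat_def)
  have 10: "B 1 0 = 1" by (rule forced) (simp_all add: less4 given del: One_nat_def)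
  have 11: "B 1 1 = 0" by (rule forced) (simp_all add: less4 given 10 del: One_nat_def)
  have 23: "B 2 3 = 1" by (rule forced) (simp_all add: less4 given 22 del: One_nat_def)
  have 20: "B 2 0 = 2" by (rule forced) (simp_all add: less4 given 22 23 del: One_nat_def)
  have 30: "B 3 0 = 3" by (rule forced) (simp_all add: less4 given 10 20 del: One_nat_def)
  have 01: "B 0 1 = 1" by (rule forced) (simp_all add: less4 given 02 del: One_nat_def)
  have 03: "B 0 3 = 3" by (rule forced) (simp_all add: less4 given 02 01 del: One_nat_def)
  have 31: "B 3 1 = 2" by (rule forced) (simp_all add: less4 given 01 11 del: One_nat_def)
  have 33: "B 3 3 = 0" by (rule forced) (simp_all add: less4 given 30 31 del: One_nat_def)
  have "\<forall>i<4. \<forall>j<4. B i j = xor i j"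
    by (simp add: less4 given 02 22 10 11 23 20 30 01 03 31 33 del: One_nat_def)
  then show "B i j = xor i j"
    using ij by blast
qed

section \<open>The bound\<close>

lemma minimal_critical_set_xor_card_le:
  assumes "minimal_critical_set (2 ^ n) (xor_square n) C"
    and "U \<subseteq> {..<2 ^ n} \<times> {..<2 ^ n}" "recoverable (2 ^ n) xor U"
  shows "real (card C) \<le> 4 ^ n - real (card U)"
proof -
  let ?D = "{(i, j, xor i j) | i j :: nat. i < 2 ^ n \<and> j < 2 ^ n \<and> (i, j) \<notin> U}"
  have "?D \<subseteq> (\<lambda>(i, j). (i, j, xor i j)) ` ({..<2 ^ n} \<times> {..<2 ^ n})"
    by auto
  then have "finite ?D"
    by (rule finite_subset) simp
  then have "card C \<le> card ?D"
    using minimal_critical_set_card_le[OF assms(1)[unfolded xor_square_def]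
        uniquely_completable_of_recoverable[OF latin_array_xor assms(3)]] by blast
  also have "\<dots> = 2 ^ n * 2 ^ n - card U"
    by (rule card_entries_off[OF assms(2)])
  finally have "card C + card U \<le> 2 ^ n * 2 ^ n"
    using card_mono[OF _ assms(2)] by simp
  also have "\<dots> = 4 ^ n"
    by (simp flip: power_mult_distrib)
  finally have "real (card C + card U) \<le> real (4 ^ n)"
    by (rule of_nat_mono)
  then show ?thesis
    by simp
qed

theorem theorem1:
  fixes n :: nat and C :: "entry set"
  assumes "n \<ge> 1"
    and "minimal_critical_set (2 ^ n) (xor_square n) C"
  shows "real (card C) \<le> 4 ^ n - 3 ^ n + 4 - 2 ^ n - 2 powi (int n - 2)"
proof (cases "n = 1")
  case True
  have "recoverable (2 ^ 0) xor {(0, 0)}"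
    using latin_array_less[of 1] by (auto simp: recoverable_def)
  then obtain V where "V \<subseteq> {..<2 ^ n} \<times> {..<2 ^ n}" "recoverable (2 ^ n) xor V" "card V = 3"
    using recoverable_xor_iterate[of "{(0, 0)}" 0 n] True by auto
  from minimal_critical_set_xor_card_le[OF assms(2) this(1,2)] this(3) show ?thesis
    using True by (simp add: power_int_def)
next
  case False
  then obtain m where n: "n = 2 + m"
    using assms(1) by (metis Suc_1 le_neq_implies_less le_Suc_ex less_eq_Suc_le)
  have "cells4 \<subseteq> {..<2 ^ 2} \<times> {..<2 ^ 2}" "recoverable (2 ^ 2) xor cells4"
    using recoverable_cells4 by (auto simp: cells4_def)
  then obtain V where "V \<subseteq> {..<2 ^ n} \<times> {..<2 ^ n}" "recoverable (2 ^ n) xor V"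
      "card V = 3 ^ m * 11"
    using recoverable_xor_iterate[of cells4 2 m] unfolding n card_cells4 by blast
  from minimal_critical_set_xor_card_le[OF assms(2) this(1,2)] this(3)
  have "real (card C) \<le> 4 ^ n - 11 * 3 ^ m"
    by simp
  moreover have "5 * 2 ^ m \<le> 2 * 3 ^ m + (4 :: real)"
  proof (induction m)
    case (Suc m)
    \<comment> \<open>The step needs \<open>2 \<le> 3\<^sup>m\<close>, so the passage from 0 to 1 is checked directly.\<close>
    show ?case
    proof (cases m)
      case m: (Suc k)
      then have "2 \<le> (3 :: real) ^ m"
        using one_le_power[of "3 :: real" k] by (simp del: one_le_power)
      then show ?thesis
        using Suc.IH by simp
    qed simp
  qed simp
  ultimately show ?thesis
    unfolding n by (simp add: power_add)
qed

end
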